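(* Let $X$ be an implicative-orthomodular lattice. Then the center $\mathcal{C}(X)$ of $X$ is an implicative-Boolean subalgebra of $X$; that is, $\mathcal{C}(X)$ is a subalgebra of $X$ and, with the induced operations, it is an implicative-Boolean algebra.
   Context: A BE algebra is an algebra $(X,\to,1)$ of type $(2,0)$ such that for all $x,y,z\in X$: $x\to x=1$; $x\to 1=1$; $1\to x=x$; $x\to(y\to z)=y\to(x\to z)$. Write $x\le y$ iff $x\to y=1$. It is bounded if there is $0\in X$ with $0\le x$ for all $x\in X$; then $x^*:=x\to 0$. A bounded BE algebra is involutive if $x^{**}=x$ for all $x$. A BE algebra is implicative if $(x\to y)\to x=x$ for all $x,y$. In an involutive BE algebra put $x\Cap y:=((x^*\to y^* )\to y^* )^*$. An implicative-orthomodular lattice is an implicative involutive BE algebra satisfying $x\Cap(y\to x)=x$ for all $x,y$. An element $x$ commutes with $y$, written $x\mathcal{C}y$, if $x=(x\to y^* )\to(x\to y)^*$. The center of $X$ is $\mathcal{C}(X)=\{x\in X\mid x\mathcal{C}y \text{ for all } y\in X\}$. A subalgebra of $X$ is a subset containing $0$ and $1$ and closed under $\to$. An implicative-Boolean algebra is an implicative involutive BE algebra satisfying the divisibility condition $x\to(x\to y)^*=x\to y^*$ for all $x,y$. *)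

theory Defs
  imports Main
begin

(* Algebras are given by an explicit carrier X; an induced algebra on a subset S of X is
   obtained by replacing X with S and keeping the operations imp, one, zero. *)

locale BE_algebra =
  fixes X :: "'a set"
    and imp :: "'a \<Rightarrow> 'a \<Rightarrow> 'a" (infixr "\<rightarrow>" 65)
    and one :: "'a" ("\<one>")
  assumes one_closed: "\<one> \<in> X"
    and imp_closed: "\<lbrakk>x \<in> X; y \<in> X\<rbrakk> \<Longrightarrow> x \<rightarrow> y \<in> X"
    and imp_self: "x \<in> X \<Longrightarrow> x \<rightarrow> x = \<one>"
    and imp_one: "x \<in> X \<Longrightarrow> x \<rightarrow> \<one> = \<one>"
    and one_imp: "x \<in> X \<Longrightarrow> \<one> \<rightarrow> x = x"
    and exchange: "\<lbrakk>x \<in> X; y \<in> X; z \<in> X\<rbrakk> \<Longrightarrow> x \<rightarrow> (y \<rightarrow> z) = y \<rightarrow> (x \<rightarrow> z)"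
begin

definition le :: "'a \<Rightarrow> 'a \<Rightarrow> bool" (infix "\<preceq>" 50) where
  "x \<preceq> y \<longleftrightarrow> x \<rightarrow> y = \<one>"

end

locale bounded_BE_algebra = BE_algebra +
  fixes zero :: "'a" ("\<zero>")
  assumes zero_closed: "\<zero> \<in> X"
    and zero_le: "x \<in> X \<Longrightarrow> \<zero> \<preceq> x"
begin

definition star :: "'a \<Rightarrow> 'a" ("_\<^sup>\<star>" [1000] 1000) where
  "x\<^sup>\<star> = x \<rightarrow> \<zero>"

definition meet :: "'a \<Rightarrow> 'a \<Rightarrow> 'a" (infixl "\<sqinter>" 70) where
  "x \<sqinter> y = ((x\<^sup>\<star> \<rightarrow> y\<^sup>\<star>) \<rightarrow> y\<^sup>\<star>)\<^sup>\<star>"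

definition commutes :: "'a \<Rightarrow> 'a \<Rightarrow> bool" where
  "commutes x y \<longleftrightarrow> x = (x \<rightarrow> y\<^sup>\<star>) \<rightarrow> (x \<rightarrow> y)\<^sup>\<star>"

definition center :: "'a set" where
  "center = {x \<in> X. \<forall>y \<in> X. commutes x y}"

definition subalgebra :: "'a set \<Rightarrow> bool" where
  "subalgebra S \<longleftrightarrow> S \<subseteq> X \<and> \<zero> \<in> S \<and> \<one> \<in> S \<and> (\<forall>x \<in> S. \<forall>y \<in> S. x \<rightarrow> y \<in> S)"

end

locale involutive_BE_algebra = bounded_BE_algebra +
  assumes involutive: "x \<in> X \<Longrightarrow> x\<^sup>\<star>\<^sup>\<star> = x"

locale implicative_involutive_BE_algebra = involutive_BE_algebra +
  assumes implicative: "\<lbrakk>x \<in> X; y \<in> X\<rbrakk> \<Longrightarrow> (x \<rightarrow> y) \<rightarrow> x = x"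

locale implicative_orthomodular_lattice = implicative_involutive_BE_algebra +
  assumes orthomodular: "\<lbrakk>x \<in> X; y \<in> X\<rbrakk> \<Longrightarrow> x \<sqinter> (y \<rightarrow> x) = x"

locale implicative_Boolean_algebra = implicative_involutive_BE_algebra +
  assumes divisibility: "\<lbrakk>x \<in> X; y \<in> X\<rbrakk> \<Longrightarrow> x \<rightarrow> (x \<rightarrow> y)\<^sup>\<star> = x \<rightarrow> y\<^sup>\<star>"

end

theory Submission
  imports Defs
begin

text \<open>
  With \<open>x \<squnion> y = x\<^sup>\<star> \<rightarrow> y\<close> and \<open>x \<odot> y = (x \<rightarrow> y\<^sup>\<star>)\<^sup>\<star>\<close> an implicative involutive BE algebra is an
  ortholattice (implicativity is the absorption law), \<open>x\<close> commutes with \<open>y\<close> iff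
  \<open>x = (x \<odot> y) \<squnion> (x \<odot> y\<^sup>\<star>)\<close>, and the orthomodular axiom is the usual orthomodular law, which makes
  commutation symmetric. Hence the center is closed under complements; it is closed under joins by
  monotonicity alone. Divisibility for \<open>x\<close>, \<open>y\<close> follows from absorption as soon as \<open>y\<^sup>\<star>\<close>
  commutes with \<open>x\<close>.
\<close>

context bounded_BE_algebra
begin

definition join :: "'a \<Rightarrow> 'a \<Rightarrow> 'a" (infixl "\<squnion>" 66) where
  "x \<squnion> y = x\<^sup>\<star> \<rightarrow> y"

text \<open>Not the operation \<open>\<sqinter>\<close>, which is the Sasaki projection \<open>(x \<squnion> y\<^sup>\<star>) \<odot> y\<close>.\<close>
definition inf_op :: "'a \<Rightarrow> 'a \<Rightarrow> 'a" (infixl "\<odot>" 70) where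
  "x \<odot> y = (x \<rightarrow> y\<^sup>\<star>)\<^sup>\<star>"

lemma star_closed [simp]: "x \<in> X \<Longrightarrow> x\<^sup>\<star> \<in> X"
  by (simp add: star_def imp_closed zero_closed)

lemma join_closed [simp]: "\<lbrakk>x \<in> X; y \<in> X\<rbrakk> \<Longrightarrow> x \<squnion> y \<in> X"
  by (simp add: join_def imp_closed)

lemma inf_closed [simp]: "\<lbrakk>x \<in> X; y \<in> X\<rbrakk> \<Longrightarrow> x \<odot> y \<in> X"
  by (simp add: inf_op_def imp_closed)

lemma star_zero: "\<zero>\<^sup>\<star> = \<one>"
  by (simp add: star_def imp_self zero_closed)

lemma star_one: "\<one>\<^sup>\<star> = \<zero>"
  by (simp add: star_def one_imp zero_closed)

lemma zero_imp: "x \<in> X \<Longrightarrow> \<zero> \<rightarrow> x = \<one>"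
  using zero_le by (simp add: le_def)

lemma zero_commutes: "y \<in> X \<Longrightarrow> commutes \<zero> y"
  by (simp add: commutes_def zero_imp one_imp zero_closed star_one)

end

context involutive_BE_algebra
begin

lemma star_star [simp]: "x \<in> X \<Longrightarrow> x\<^sup>\<star>\<^sup>\<star> = x"
  by (rule involutive)

lemma imp_eq_join: "x \<in> X \<Longrightarrow> x \<rightarrow> y = x\<^sup>\<star> \<squnion> y"
  by (simp add: join_def)

text \<open>This is contraposition: exchange with \<open>\<zero>\<close> as the innermost argument
  swaps \<open>x\<^sup>\<star>\<close> and \<open>y\<^sup>\<star>\<close>, and involution removes
  the double stars.\<close>

lemma join_commute:
  assumes "x \<in> X" "y \<in> X"
  shows "x \<squnion> y = y \<squnion> x"
  using exchange[of "x\<^sup>\<star>" "y\<^sup>\<star>" \<zero>] assms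
  by (simp add: join_def zero_closed flip: star_def)

lemma join_left_commute:
  "\<lbrakk>x \<in> X; y \<in> X; z \<in> X\<rbrakk> \<Longrightarrow> x \<squnion> (y \<squnion> z) = y \<squnion> (x \<squnion> z)"
  by (simp add: join_def exchange)

lemma join_assoc:
  assumes "x \<in> X" "y \<in> X" "z \<in> X"
  shows "x \<squnion> y \<squnion> z = x \<squnion> (y \<squnion> z)"
  using assms by (metis join_closed join_commute join_left_commute)

lemmas join_ac = join_assoc join_commute join_left_commute

lemma star_join: "\<lbrakk>x \<in> X; y \<in> X\<rbrakk> \<Longrightarrow> (x \<squnion> y)\<^sup>\<star> = x\<^sup>\<star> \<odot> y\<^sup>\<star>"
  by (simp add: join_def inf_op_def)

lemma star_inf: "\<lbrakk>x \<in> X; y \<in> X\<rbrakk> \<Longrightarrow> (x \<odot> y)\<^sup>\<star> = x\<^sup>\<star> \<squnion> y\<^sup>\<star>"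
  by (simp add: join_def inf_op_def imp_closed)

lemma inf_eq: "\<lbrakk>x \<in> X; y \<in> X\<rbrakk> \<Longrightarrow> x \<odot> y = (x\<^sup>\<star> \<squnion> y\<^sup>\<star>)\<^sup>\<star>"
  by (simp add: star_join)

lemma inf_commute: "\<lbrakk>x \<in> X; y \<in> X\<rbrakk> \<Longrightarrow> x \<odot> y = y \<odot> x"
  by (simp add: inf_eq join_commute)

lemma inf_left_commute:
  "\<lbrakk>x \<in> X; y \<in> X; z \<in> X\<rbrakk> \<Longrightarrow> x \<odot> (y \<odot> z) = y \<odot> (x \<odot> z)"
  by (simp add: inf_eq join_left_commute)

lemma inf_assoc: "\<lbrakk>x \<in> X; y \<in> X; z \<in> X\<rbrakk> \<Longrightarrow> x \<odot> y \<odot> z = x \<odot> (y \<odot> z)"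
  by (simp add: inf_eq join_assoc)

lemma commutes_iff:
  "\<lbrakk>x \<in> X; y \<in> X\<rbrakk> \<Longrightarrow> commutes x y \<longleftrightarrow> x = (x \<odot> y) \<squnion> (x \<odot> y\<^sup>\<star>)"
  by (simp add: commutes_def join_def inf_op_def imp_closed)

lemma commutes_star_right:
  "\<lbrakk>x \<in> X; y \<in> X; commutes x y\<rbrakk> \<Longrightarrow> commutes x y\<^sup>\<star>"
  by (simp add: commutes_iff join_commute)

end

context implicative_involutive_BE_algebra
begin

lemma join_absorb:
  assumes "x \<in> X" "y \<in> X"
  shows "x \<squnion> (x \<odot> y) = x"
proof -
  have "(x \<odot> y) \<squnion> x = x"
    using implicative[of x "y\<^sup>\<star>"] assms by (simp add: join_def inf_op_def imp_closed)
  then show ?thesis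
    using assms by (simp add: join_commute)
qed

lemma inf_absorb:
  assumes "x \<in> X" "y \<in> X"
  shows "x \<odot> (x \<squnion> y) = x"
  using join_absorb[of "x\<^sup>\<star>" "y\<^sup>\<star>"] assms by (simp add: inf_eq)

text \<open>Monotonicity of meeting with \<open>c\<close>, where u below v is encoded as
  \<open>u \<squnion> v = v\<close>; the relation \<open>\<preceq>\<close> is in general strictly
  weaker than this lattice order.\<close>

lemma inf_mono_join:
  assumes "a \<in> X" "b \<in> X" "c \<in> X"
  shows "(a \<odot> c) \<squnion> ((a \<squnion> b) \<odot> c) = (a \<squnion> b) \<odot> c"
proof -
  have "((a \<squnion> b) \<odot> c) \<odot> a = (a \<odot> (a \<squnion> b)) \<odot> c"
    using assms by (simp add: inf_assoc inf_commute inf_left_commute)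
  also have "\<dots> = a \<odot> c"
    using assms by (simp add: inf_absorb)
  finally show ?thesis
    using join_absorb[of "(a \<squnion> b) \<odot> c" a] assms by (simp add: join_commute)
qed

lemma commutes_join:
  assumes X: "a \<in> X" "b \<in> X" "c \<in> X" and "commutes a c" "commutes b c"
  shows "commutes (a \<squnion> b) c"
proof -
  \<comment> \<open>The two pieces of \<open>a \<squnion> b\<close> along \<open>c\<close>; it
    remains to see that they join to \<open>a \<squnion> b\<close>.\<close>
  define p q where "p = (a \<squnion> b) \<odot> c" and "q = (a \<squnion> b) \<odot> c\<^sup>\<star>"
  have pq: "p \<in> X" "q \<in> X"
    using X by (simp_all add: p_def q_def)
  have a: "a = (a \<odot> c) \<squnion> (a \<odot> c\<^sup>\<star>)" and b: "b = (b \<odot> c) \<squnion> (b \<odot> c\<^sup>\<star>)"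
    using assms by (simp_all add: commutes_iff)
  have ap: "(a \<odot> c) \<squnion> p = p" and aq: "(a \<odot> c\<^sup>\<star>) \<squnion> q = q"
    using X by (simp_all add: inf_mono_join p_def q_def)
  have bp: "(b \<odot> c) \<squnion> p = p" and bq: "(b \<odot> c\<^sup>\<star>) \<squnion> q = q"
    using X inf_mono_join[of b a] by (simp_all add: join_commute[of a b] p_def q_def)
  \<comment> \<open>The pieces of \<open>a\<close> along \<open>c\<close> lie below \<open>p\<close>
    and \<open>q\<close> respectively, so \<open>a\<close> lies below \<open>p \<squnion> q\<close>;
    \<open>b\<close> is treated likewise.\<close>
  have "a \<squnion> (p \<squnion> q) = ((a \<odot> c) \<squnion> (a \<odot> c\<^sup>\<star>)) \<squnion> (p \<squnion> q)"
    using a by simp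
  also have "\<dots> = ((a \<odot> c) \<squnion> p) \<squnion> ((a \<odot> c\<^sup>\<star>) \<squnion> q)"
    using X pq by (simp add: join_ac)
  finally have a_le: "a \<squnion> (p \<squnion> q) = p \<squnion> q"
    by (simp add: ap aq)
  have "b \<squnion> (p \<squnion> q) = ((b \<odot> c) \<squnion> (b \<odot> c\<^sup>\<star>)) \<squnion> (p \<squnion> q)"
    using b by simp
  also have "\<dots> = ((b \<odot> c) \<squnion> p) \<squnion> ((b \<odot> c\<^sup>\<star>) \<squnion> q)"
    using X pq by (simp add: join_ac)
  finally have b_le: "b \<squnion> (p \<squnion> q) = p \<squnion> q"
    by (simp add: bp bq)
  \<comment> \<open>Antisymmetry in equational form: \<open>p \<squnion> q\<close> absorbs
    \<open>a\<close> and \<open>b\<close>, while \<open>a \<squnion> b\<close> absorbs its own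
    pieces \<open>p\<close> and \<open>q\<close>.\<close>
  have "p \<squnion> q = (a \<squnion> b) \<squnion> (p \<squnion> q)"
    using X pq by (simp add: join_assoc a_le b_le)
  also have "\<dots> = ((a \<squnion> b) \<squnion> p) \<squnion> q"
    using X pq by (simp add: join_assoc)
  also have "\<dots> = a \<squnion> b"
    unfolding p_def q_def using X by (simp add: join_absorb)
  finally show ?thesis
    using X by (simp add: commutes_iff p_def q_def)
qed

text \<open>In lattice form the claim is \<open>x\<^sup>\<star> \<squnion> (x \<odot>
  y\<^sup>\<star>) = x\<^sup>\<star> \<squnion> y\<^sup>\<star>\<close>. Split
  \<open>y\<^sup>\<star>\<close> along \<open>x\<close>: the piece below
  \<open>x\<^sup>\<star>\<close> is absorbed.\<close>

lemma divisibility_if_commutes: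
  assumes X: "x \<in> X" "y \<in> X" and "commutes y\<^sup>\<star> x"
  shows "x \<rightarrow> (x \<rightarrow> y)\<^sup>\<star> = x \<rightarrow> y\<^sup>\<star>"
proof -
  have "y\<^sup>\<star> = (y\<^sup>\<star> \<odot> x) \<squnion> (y\<^sup>\<star> \<odot> x\<^sup>\<star>)"
    using assms by (simp add: commutes_iff)
  then have "x\<^sup>\<star> \<squnion> y\<^sup>\<star> = x\<^sup>\<star> \<squnion> ((x \<odot> y\<^sup>\<star>) \<squnion> (x\<^sup>\<star> \<odot> y\<^sup>\<star>))"
    using X by (simp add: inf_commute)
  also have "\<dots> = (x \<odot> y\<^sup>\<star>) \<squnion> (x\<^sup>\<star> \<squnion> (x\<^sup>\<star> \<odot> y\<^sup>\<star>))"
    using X by (simp add: join_left_commute)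
  also have "\<dots> = x\<^sup>\<star> \<squnion> (x \<odot> y\<^sup>\<star>)"
    using X by (simp add: join_absorb join_commute)
  finally show ?thesis
    using X by (simp add: imp_eq_join star_join)
qed

end

context implicative_orthomodular_lattice
begin

text \<open>De Morgan dual of the axiom at \<open>y\<^sup>\<star>\<close> and \<open>x\<close>,
  where \<open>x \<rightarrow> y\<^sup>\<star>\<close> is the complement of
  \<open>x \<odot> y\<close>.\<close>

lemma orthomodular_law:
  assumes "x \<in> X" "y \<in> X"
  shows "(y \<odot> x) \<squnion> (y \<odot> (y \<odot> x)\<^sup>\<star>) = y"
proof -
  have "(y\<^sup>\<star> \<squnion> (x \<odot> y)) \<odot> (x\<^sup>\<star> \<squnion> y\<^sup>\<star>) = y\<^sup>\<star>"
    using orthomodular[of "y\<^sup>\<star>" x] assms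
    by (simp add: meet_def imp_eq_join star_join star_inf)
  then have "((y\<^sup>\<star> \<squnion> (x \<odot> y)) \<odot> (x\<^sup>\<star> \<squnion> y\<^sup>\<star>))\<^sup>\<star> = y"
    using assms by simp
  then show ?thesis
    using assms by (simp add: star_inf star_join join_commute inf_commute)
qed

text \<open>Complementing the splitting of \<open>x\<close> and meeting with \<open>y\<close>
  absorbs the factor \<open>y \<squnion> x\<^sup>\<star>\<close>. This leaves \<open>y \<odot>
  x\<^sup>\<star> = y \<odot> (y \<odot> x)\<^sup>\<star>\<close>, which turns the orthomodular law
  into the splitting of \<open>y\<close> along \<open>x\<close>.\<close>

lemma commutes_sym:
  assumes X: "x \<in> X" "y \<in> X" and "commutes x y"
  shows "commutes y x"
proof -
  have "x = (x \<odot> y) \<squnion> (x \<odot> y\<^sup>\<star>)"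
    using assms by (simp add: commutes_iff)
  then have "x\<^sup>\<star> = (x \<odot> y)\<^sup>\<star> \<odot> (x \<odot> y\<^sup>\<star>)\<^sup>\<star>"
    using X by (metis star_join inf_closed star_closed)
  then have "y \<odot> x\<^sup>\<star> = (x \<odot> y)\<^sup>\<star> \<odot> (y \<odot> (y \<squnion> x\<^sup>\<star>))"
    using X by (simp add: inf_left_commute star_inf[of x "y\<^sup>\<star>"] join_commute)
  also have "\<dots> = y \<odot> (y \<odot> x)\<^sup>\<star>"
    using X by (simp add: inf_absorb inf_commute)
  finally show ?thesis
    using X orthomodular_law[of x y] by (simp add: commutes_iff)
qed

text \<open>Complementing the right argument only swaps the two pieces; symmetry, and hence
  orthomodularity, carries this over to the left.\<close>

lemma commutes_star_left:
  "\<lbrakk>x \<in> X; y \<in> X; commutes x y\<rbrakk> \<Longrightarrow> commutes x\<^sup>\<star> y"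
  by (meson commutes_sym commutes_star_right star_closed)

lemma star_center: "x \<in> center \<Longrightarrow> x\<^sup>\<star> \<in> center"
  by (simp add: center_def commutes_star_left)

lemma zero_center: "\<zero> \<in> center"
  by (simp add: center_def zero_closed zero_commutes)

lemma one_center: "\<one> \<in> center"
  using star_center[OF zero_center] by (simp add: star_zero)

lemma imp_center: "\<lbrakk>x \<in> center; y \<in> center\<rbrakk> \<Longrightarrow> x \<rightarrow> y \<in> center"
  by (simp add: center_def imp_eq_join commutes_join commutes_star_left)

lemma subalgebra_center: "subalgebra center"
  by (auto simp: subalgebra_def zero_center one_center imp_center) (simp add: center_def)

lemma center_subset: "x \<in> center \<Longrightarrow> x \<in> X"
  by (simp add: center_def)

lemma center_Boolean: "implicative_Boolean_algebra center imp one zero"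
proof -
  \<comment> \<open>Needed for divisibility, the one axiom that \<open>X\<close> itself may
    fail.\<close>
  have comm: "commutes y\<^sup>\<star> x" if "x \<in> center" "y \<in> center" for x y
    using star_center[OF \<open>y \<in> center\<close>] center_subset[OF \<open>x \<in> center\<close>] by (simp add: center_def)
  \<comment> \<open>The complement is built from \<open>imp\<close> and \<open>zero\<close> alone,
    so it is the same in the center as in \<open>X\<close>, and the identities of \<open>X\<close>
    restrict.\<close>
  interpret C: BE_algebra center imp one
    by unfold_locales
      (simp_all add: one_center imp_center center_subset imp_self imp_one one_imp exchange)
  interpret C: bounded_BE_algebra center imp one zero
    by unfold_locales (simp_all add: zero_center center_subset zero_le)
  from comm show ?thesis
    by unfold_locales
      (simp_all add: center_subset implicative divisibility_if_commutes)
qed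

end

theorem theorem5p4:
  fixes X :: "'a set" and imp :: "'a \<Rightarrow> 'a \<Rightarrow> 'a" and one zero :: 'a
  assumes "implicative_orthomodular_lattice X imp one zero"
  shows "bounded_BE_algebra.subalgebra X imp one zero (bounded_BE_algebra.center X imp zero) \<and>
    implicative_Boolean_algebra (bounded_BE_algebra.center X imp zero) imp one zero"
  using implicative_orthomodular_lattice.subalgebra_center[OF assms]
    implicative_orthomodular_lattice.center_Boolean[OF assms]
  by blast

end
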